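(* For any $k_0\in\mathbb{N}_0$ and $l_0\in\mathbb{N}$, $$a_{k_0+l_0,k_0}=\sum_{p=0}^{l_0-1}\ \prod_{s=1}^{p}\left(\sum_{k_s=p-s}^{k_{s-1}-1}\ \sum_{l_s=p-s+1}^{l_{s-1}-1}\right)\prod_{s=1}^{p}\beta_{k_s+l_{s-1},\,k_s+l_s}\ \sum_{j=0}^{k_p}\beta_{j+l_p-1,\,j-1},$$ where $\beta_{s,t}=\overline{\alpha}_s\alpha_t$.
   Context: $\mu$ is a probability measure with infinite support on the unit circle $\partial\mathbb{D}$. $\Phi_n$ ($n\ge 0$) are the monic orthogonal polynomials of $\mu$ in $L^2(d\mu)$, written $\Phi_n(z)=z^n+a_{n,n-1}z^{n-1}+\cdots+a_{n,1}z+a_{n,0}$. The Verblunsky coefficients are $\alpha_n=-\overline{\Phi_{n+1}(0)}\in\mathbb{D}$ for $n\ge 0$, with the convention $\alpha_{-1}=-1$; they satisfy the Szegő recursion $\Phi_{n+1}(z)=z\Phi_n(z)-\overline{\alpha}_n\Phi_n^*(z)$ with $\Phi_n^*(z)=z^n\overline{\Phi_n(1/\overline z)}$. $\mathbb{N}=\{1,2,\dots\}$, $\mathbb{N}_0=\mathbb{N}\cup\{0\}$. Notation for multiple sums: $\prod_{s=1}^{p}\big(\sum_{k_s=p-s}^{k_{s-1}-1}\sum_{l_s=p-s+1}^{l_{s-1}-1}\big)X$ denotes the iterated sum $\sum_{k_1=p-1}^{k_0-1}\sum_{l_1=p}^{l_0-1}\sum_{k_2=p-2}^{k_1-1}\sum_{l_2=p-1}^{l_1-1}\cdots\sum_{k_p=0}^{k_{p-1}-1}\sum_{l_p=1}^{l_{p-1}-1}X$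 (the whole remaining expression $X$ is inside all sums). Empty sums are $0$; empty products are $1$, so for $p=0$ the term is just $\sum_{j=0}^{k_0}\beta_{j+l_0-1,j-1}$. *)

theory Defs
  imports "HOL-Probability.Probability" "HOL-Computational_Algebra.Polynomial"
begin

definition measure_support :: "'a::topological_space measure \<Rightarrow> 'a set" where
  "measure_support \<mu> =
     {x \<in> space \<mu>. \<forall>U. open U \<and> x \<in> U \<longrightarrow> emeasure \<mu> (U \<inter> space \<mu>) > 0}"

text \<open>The measure lives on the Borel sets of the circle itself; its \<^const>\<open>space\<close> is the circle.\<close>

definition circle_prob_measure :: "complex measure \<Rightarrow> bool" where
  "circle_prob_measure \<mu> \<longleftrightarrow>
     prob_space \<mu> \<and> sets \<mu> = sets (restrict_space borel (sphere 0 1))"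

definition monic_orthogonal_polys :: "complex measure \<Rightarrow> (nat \<Rightarrow> complex poly) \<Rightarrow> bool" where
  "monic_orthogonal_polys \<mu> \<Phi> \<longleftrightarrow>
     (\<forall>n. degree (\<Phi> n) = n \<and> lead_coeff (\<Phi> n) = 1) \<and>
     (\<forall>m n. m \<noteq> n \<longrightarrow> (\<integral>z. cnj (poly (\<Phi> m) z) * poly (\<Phi> n) z \<partial>\<mu>) = 0)"

text \<open>Indices are integers because of the convention that the coefficient at \<open>-1\<close> is \<open>-1\<close>;
  values at indices below \<open>-1\<close> are meaningless and never used.\<close>

definition verblunsky :: "(nat \<Rightarrow> complex poly) \<Rightarrow> int \<Rightarrow> complex" where
  "verblunsky \<Phi> n = (if n = -1 then -1 else - cnj (poly (\<Phi> (nat (n + 1))) 0))"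

definition verblunsky_beta :: "(nat \<Rightarrow> complex poly) \<Rightarrow> int \<Rightarrow> int \<Rightarrow> complex" where
  "verblunsky_beta \<Phi> s t = cnj (verblunsky \<Phi> s) * verblunsky \<Phi> t"

text \<open>\<open>iterated_sum p X s k l\<close> performs the double summations with numbers \<open>s, \<dots>, p\<close>, the
  values of the earlier summation variables being recorded in \<open>k\<close> and \<open>l\<close> (at indices
  \<open>0, \<dots>, s - 1\<close>). Each chosen pair is stored at index \<open>s\<close>, so that the innermost summand
  \<open>X\<close> sees all the summation variables. The half-open intervals encode the upper limits
  \<open>k (s - 1) - 1\<close> and \<open>l (s - 1) - 1\<close> without truncated subtraction; the
  subtractions \<open>p - s\<close> and \<open>s - 1\<close> are exact when the recursion starts at \<open>s = 1\<close>.\<close>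

function iterated_sum ::
  "nat \<Rightarrow> ((nat \<Rightarrow> nat) \<Rightarrow> (nat \<Rightarrow> nat) \<Rightarrow> complex) \<Rightarrow> nat \<Rightarrow> (nat \<Rightarrow> nat) \<Rightarrow> (nat \<Rightarrow> nat) \<Rightarrow> complex"
where
  "iterated_sum p X s k l =
     (if s > p then X k l
      else \<Sum>k'\<in>{p - s..<k (s - 1)}. \<Sum>l'\<in>{p - s + 1..<l (s - 1)}.
             iterated_sum p X (Suc s) (k(s := k')) (l(s := l')))"
  by auto
termination by (relation "Wellfounded.measure (\<lambda>(p, X, s, k, l). Suc p - s)") auto

declare iterated_sum.simps [simp del]

end

theory Submission
  imports Defs
begin

text \<open>
  Orthogonality and the infinite support yield the Szego recursion. Comparing coefficients in it
  and telescoping in \<open>k\<close> expresses \<open>a k l\<close>, the coefficient of \<open>z ^ k\<close> in \<open>\<Phi> (k + l)\<close>, as a sum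
  over the conjugates of \<open>a (l - 1) j\<close> with \<open>j \<le> k\<close>. Applying this identity twice removes the
  conjugates and gives
  \[
    a_{k+l,k} = \sum_{j=0}^{k} \beta_{j+l-1,j-1}
      + \sum_{k'=0}^{k-1} \sum_{l'=1}^{l-1} \beta_{k'+l,k'+l'} \, a_{k'+l',k'},
  \]
  whose iteration is the claim. The lower summation limits in the claim only discard terms that
  contain an empty sum.
\<close>

section \<open>The Szego recursion\<close>

definition poly_inner :: "complex measure \<Rightarrow> complex poly \<Rightarrow> complex poly \<Rightarrow> complex" where
  "poly_inner \<mu> p q = (\<integral>z. cnj (poly p z) * poly q z \<partial>\<mu>)"

text \<open>\<open>reflect_poly (map_poly cnj p)\<close> is the reversed polynomial p^*, taken at
  the actual degree of \<open>p\<close>; on the circle the point 1/z in its definition is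
  \<open>cnj z\<close>.\<close>

lemma poly_reflect_cnj_on_circle:
  assumes "norm z = 1"
  shows "poly (reflect_poly (map_poly cnj p)) z = z ^ degree p * cnj (poly p z)"
proof -
  have "z \<noteq> 0" using assms by auto
  moreover have "inverse z = cnj z"
    using assms by (intro inverse_unique) (simp flip: complex_norm_square)
  ultimately show ?thesis
    by (simp add: poly_reflect_poly_nz degree_map_poly)
qed

context
  fixes \<mu> :: "complex measure"
  assumes circle: "circle_prob_measure \<mu>"
begin

lemma space_circle: "space \<mu> = sphere 0 1"
  using circle sets_eq_imp_space_eq[of \<mu> "restrict_space borel (sphere 0 1)"]
  unfolding circle_prob_measure_def by (simp add: space_restrict_space)

lemma integrable_continuous_circle:
  fixes f :: "complex \<Rightarrow> 'a::{banach, second_countable_topology}"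
  assumes "continuous_on UNIV f"
  shows "integrable \<mu> f"
proof -
  interpret prob_space \<mu> using circle by (simp add: circle_prob_measure_def)
  have "f \<in> borel_measurable (restrict_space borel (sphere 0 1))"
    using borel_measurable_continuous_onI[OF assms] by (rule measurable_restrict_space1)
  then have meas: "f \<in> borel_measurable \<mu>"
    using circle by (simp add: circle_prob_measure_def cong: measurable_cong_sets)
  have "bounded (f ` sphere 0 1)"
    by (intro compact_imp_bounded compact_continuous_image continuous_on_subset[OF assms]) auto
  then obtain B where "\<And>z. z \<in> sphere 0 1 \<Longrightarrow> norm (f z) \<le> B"
    unfolding bounded_iff by blast
  then show ?thesis
    using meas by (intro integrable_const_bound[where B = B] AE_I2) (auto simp: space_circle)
qed

lemma integrable_inner: "integrable \<mu> (\<lambda>z. cnj (poly p z) * poly q z)"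
  by (intro integrable_continuous_circle continuous_intros)

lemma poly_inner_diff_left: "poly_inner \<mu> (p - q) r = poly_inner \<mu> p r - poly_inner \<mu> q r"
  unfolding poly_inner_def
  by (simp add: left_diff_distrib integrable_inner flip: Bochner_Integration.integral_diff)

lemma poly_inner_diff_right: "poly_inner \<mu> p (q - r) = poly_inner \<mu> p q - poly_inner \<mu> p r"
  unfolding poly_inner_def
  by (simp add: right_diff_distrib integrable_inner flip: Bochner_Integration.integral_diff)

lemma poly_inner_smult_left: "poly_inner \<mu> (smult c p) q = cnj c * poly_inner \<mu> p q"
  unfolding poly_inner_def by (simp add: mult.assoc)

lemma poly_inner_smult_right: "poly_inner \<mu> p (smult c q) = c * poly_inner \<mu> p q"
  unfolding poly_inner_def by (simp add: mult.left_commute)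

lemma poly_inner_commute: "poly_inner \<mu> q p = cnj (poly_inner \<mu> p q)"
  unfolding poly_inner_def by (subst Bochner_Integration.integral_cnj[symmetric]) (simp add: mult.commute)

lemma poly_inner_shift: "poly_inner \<mu> (pCons 0 p) (pCons 0 q) = poly_inner \<mu> p q"
  unfolding poly_inner_def
proof (rule Bochner_Integration.integral_cong[OF refl])
  fix z assume "z \<in> space \<mu>"
  then have "cnj z * z = 1"
    by (simp add: space_circle mult.commute flip: complex_norm_square)
  then show "cnj (poly (pCons 0 p) z) * poly (pCons 0 q) z = cnj (poly p z) * poly q z"
    by (simp add: algebra_simps)
qed

text \<open>On the circle both integrands equal
  \<open>z ^ degree q * cnj (poly p z) * cnj (poly q z)\<close>. This trades the reversal of
  \<open>q\<close> for \<open>q\<close> itself, so that orthogonality can be applied.\<close>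

lemma poly_inner_reflect:
  assumes "degree p \<le> degree q"
  shows "poly_inner \<mu> p (reflect_poly (map_poly cnj q)) =
    poly_inner \<mu> q (monom 1 (degree q - degree p) * reflect_poly (map_poly cnj p))"
  unfolding poly_inner_def
proof (rule Bochner_Integration.integral_cong[OF refl])
  fix z assume "z \<in> space \<mu>"
  moreover have "z ^ (degree q - degree p) * z ^ degree p = z ^ degree q"
    using assms by (simp flip: power_add)
  ultimately show "cnj (poly p z) * poly (reflect_poly (map_poly cnj q)) z =
    cnj (poly q z) * poly (monom 1 (degree q - degree p) * reflect_poly (map_poly cnj p)) z"
    by (simp add: space_circle poly_reflect_cnj_on_circle poly_monom algebra_simps)
qed

text \<open>Such a \<open>p\<close> vanishes almost everywhere. Its non-zeros form an open set, here
  null, so every support point is a root, and a nonzero polynomial has only finitely many.\<close>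

lemma poly_inner_self_eq_0_imp:
  assumes "infinite (measure_support \<mu>)" "poly_inner \<mu> p p = 0"
  shows "p = 0"
proof (rule ccontr)
  assume "p \<noteq> 0"
  have int: "integrable \<mu> (\<lambda>z. (norm (poly p z))\<^sup>2)"
    by (intro integrable_continuous_circle continuous_intros)
  have "complex_of_real (\<integral>z. (norm (poly p z))\<^sup>2 \<partial>\<mu>) = poly_inner \<mu> p p"
    unfolding poly_inner_def
    by (subst integral_complex_of_real[symmetric])
      (simp only: complex_norm_square mult.commute)
  then have "(\<integral>z. (norm (poly p z))\<^sup>2 \<partial>\<mu>) = 0"
    using assms(2) by simp
  then have "AE z in \<mu>. poly p z = 0"
    using integral_nonneg_eq_0_iff_AE[OF int] by simp
  then obtain N where N: "N \<in> sets \<mu>" "emeasure \<mu> N = 0" "{z \<in> space \<mu>. poly p z \<noteq> 0} \<subseteq> N"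
    by (auto elim!: AE_E)
  have "measure_support \<mu> \<subseteq> {z. poly p z = 0}"
  proof (rule subsetI, rule ccontr)
    fix x assume x: "x \<in> measure_support \<mu>" "x \<notin> {z. poly p z = 0}"
    have "open {z. poly p z \<noteq> 0}"
      by (intro open_Collect_neq continuous_intros)
    then have "emeasure \<mu> ({z. poly p z \<noteq> 0} \<inter> space \<mu>) > 0"
      using x unfolding measure_support_def by blast
    moreover have "emeasure \<mu> ({z. poly p z \<noteq> 0} \<inter> space \<mu>) \<le> emeasure \<mu> N"
      using N by (intro emeasure_mono) auto
    ultimately show False using N(2) by simp
  qed
  then show False
    using assms(1) poly_roots_finite[OF \<open>p \<noteq> 0\<close>] finite_subset by blast
qed

context
  fixes \<Phi> :: "nat \<Rightarrow> complex poly"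
  assumes monic_orth: "monic_orthogonal_polys \<mu> \<Phi>"
begin

lemma degree_orth_poly: "degree (\<Phi> n) = n"
  and coeff_orth_poly_self: "coeff (\<Phi> n) n = 1"
  using monic_orth unfolding monic_orthogonal_polys_def by metis+

lemma orth_poly_0: "\<Phi> 0 = 1"
  using degree_orth_poly[of 0] coeff_orth_poly_self[of 0]
  by (auto elim!: degree_eq_zeroE simp: one_pCons)

text \<open>Subtracting a multiple of \<open>\<Phi> m\<close> clears the coefficient of
  \<open>z ^ m\<close>. Bounding coefficients instead of the degree lets the induction start at
  \<open>m = 0\<close>, where \<open>p\<close> is zero.\<close>

lemma poly_inner_orth_poly_lower:
  assumes "\<And>i. i \<ge> m \<Longrightarrow> coeff p i = 0" "m \<le> n"
  shows "poly_inner \<mu> p (\<Phi> n) = 0"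
  using assms
proof (induction m arbitrary: p)
  case 0
  then have "p = 0" by (simp add: poly_eq_iff)
  then show ?case by (simp add: poly_inner_def)
next
  case (Suc m)
  define q where "q = p - smult (coeff p m) (\<Phi> m)"
  have "coeff q i = 0" if "i \<ge> m" for i
    using that Suc.prems(1)[of i] coeff_eq_0[of "\<Phi> m" i]
    by (cases "i = m") (auto simp: q_def coeff_orth_poly_self degree_orth_poly)
  then have "poly_inner \<mu> q (\<Phi> n) = 0"
    using Suc by auto
  moreover have "poly_inner \<mu> (\<Phi> m) (\<Phi> n) = 0"
    using monic_orth Suc.prems(2) unfolding monic_orthogonal_polys_def poly_inner_def by auto
  ultimately show ?case
    by (simp add: q_def poly_inner_diff_left poly_inner_smult_left)
qed

text \<open>The defect of the recursion has degree at most \<open>n\<close>, vanishes at \<open>0\<close>, and each of its three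
  parts is orthogonal to \<open>z, \<dots>, z ^ n\<close>; so it is orthogonal to itself.\<close>

theorem szego_recursion:
  assumes "infinite (measure_support \<mu>)"
  shows "\<Phi> (Suc n) =
    pCons 0 (\<Phi> n) + smult (poly (\<Phi> (Suc n)) 0) (reflect_poly (map_poly cnj (\<Phi> n)))"
proof -
  let ?R = "reflect_poly (map_poly cnj (\<Phi> n))"
  define D where "D = \<Phi> (Suc n) - pCons 0 (\<Phi> n) - smult (poly (\<Phi> (Suc n)) 0) ?R"
  have "coeff ?R i = 0" if "i > n" for i
    using that by (simp add: coeff_reflect_poly degree_map_poly degree_orth_poly)
  moreover have "coeff (\<Phi> (Suc n)) i = coeff (pCons 0 (\<Phi> n)) i" if "i > n" for i
    using that coeff_eq_0[of "\<Phi> (Suc n)" i] coeff_eq_0[of "pCons 0 (\<Phi> n)" i]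
    by (cases "i = Suc n") (auto simp: coeff_orth_poly_self degree_orth_poly degree_pCons_eq_if)
  ultimately have D_high: "coeff D i = 0" if "i > n" for i
    using that by (simp add: D_def)
  have D_0: "coeff D 0 = 0"
    by (simp add: D_def coeff_reflect_poly degree_map_poly coeff_map_poly degree_orth_poly
        coeff_orth_poly_self poly_0_coeff_0)
  have deg_D: "degree D \<le> degree (\<Phi> n)"
    using D_high by (simp add: degree_orth_poly degree_le)
  obtain E where E: "D = pCons 0 E"
    using D_0 by (cases D) auto
  have "poly_inner \<mu> D (\<Phi> (Suc n)) = 0"
    using D_high by (intro poly_inner_orth_poly_lower[of "Suc n"]) auto
  moreover have "poly_inner \<mu> D (pCons 0 (\<Phi> n)) = 0"
  proof -
    have "coeff E i = 0" if "i \<ge> n" for i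
      using D_high[of "Suc i"] that by (simp add: E)
    then show ?thesis
      unfolding E poly_inner_shift by (intro poly_inner_orth_poly_lower[of n]) auto
  qed
  moreover have "poly_inner \<mu> D ?R = 0"
  proof -
    \<comment> \<open>The monomial pads the reversal of \<open>D\<close> to formal degree
      \<open>n\<close>. Its coefficient at \<open>n\<close> is the conjugate of
      \<open>coeff D 0\<close>, which is zero.\<close>
    let ?G = "monom 1 (n - degree D) * reflect_poly (map_poly cnj D)"
    have "coeff ?G i = 0" if "i \<ge> n" for i
      using that deg_D D_0
      by (cases "i = n") (auto simp: coeff_monom_mult coeff_reflect_poly degree_map_poly
          coeff_map_poly degree_orth_poly)
    then have "poly_inner \<mu> ?G (\<Phi> n) = 0"
      by (intro poly_inner_orth_poly_lower[of n]) auto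
    then show ?thesis
      using poly_inner_reflect[OF deg_D] poly_inner_commute[of "\<Phi> n" ?G]
      by (simp add: degree_orth_poly)
  qed
  ultimately have "poly_inner \<mu> D D = 0"
    by (subst (2) D_def) (simp add: poly_inner_diff_right poly_inner_smult_right)
  then have "D = 0"
    using poly_inner_self_eq_0_imp[OF assms] by blast
  then show ?thesis by (simp add: D_def algebra_simps)
qed

section \<open>The recurrence for the coefficients\<close>

text \<open>One step of the recursion lowers the degree and the coefficient index together, keeping
  \<open>l\<close> fixed; the reversal turns index \<open>k\<close> of \<open>\<Phi> (k + l)\<close>
  into index \<open>l\<close>. At \<open>k = 0\<close> the shifted term vanishes.\<close>

lemma coeff_orth_poly_telescoped:
  assumes "infinite (measure_support \<mu>)"
  shows "coeff (\<Phi> (k + Suc l)) k =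
    (\<Sum>j\<le>k. poly (\<Phi> (Suc (j + l))) 0 * cnj (coeff (\<Phi> (l + j)) l))"
proof -
  have step: "coeff (\<Phi> (Suc (k + l))) k =
      coeff (pCons 0 (\<Phi> (k + l))) k + poly (\<Phi> (Suc (k + l))) 0 * cnj (coeff (\<Phi> (l + k)) l)"
    for k
    by (subst szego_recursion[OF assms])
      (simp add: coeff_reflect_poly degree_map_poly coeff_map_poly degree_orth_poly add.commute)
  show ?thesis
  proof (induction k)
    case 0
    then show ?case using step[of 0] by simp
  next
    case (Suc k)
    then show ?case using step[of "Suc k"] by simp
  qed
qed

text \<open>The convention \<open>\<alpha>\<^sub>-\<^sub>1 = -1\<close> is the case \<open>n = 0\<close>, because \<open>\<Phi> 0 = 1\<close>.\<close>

lemma verblunsky_eq: "verblunsky \<Phi> (int n - 1) = - cnj (poly (\<Phi> n) 0)"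
  by (auto simp: verblunsky_def orth_poly_0)

lemma verblunsky_beta_eq:
  "verblunsky_beta \<Phi> (int m - 1) (int n - 1) = poly (\<Phi> m) 0 * cnj (poly (\<Phi> n) 0)"
  by (simp add: verblunsky_beta_def verblunsky_eq)

lemma coeff_orth_poly_recurrence:
  assumes "infinite (measure_support \<mu>)" "l \<ge> 1"
  shows "coeff (\<Phi> (k + l)) k =
    (\<Sum>j = 0..k. verblunsky_beta \<Phi> (int j + int l - 1) (int j - 1)) +
    (\<Sum>k'<k. \<Sum>l'\<in>{1..<l}.
      verblunsky_beta \<Phi> (int k' + int l) (int k' + int l') * coeff (\<Phi> (k' + l')) k')"
proof -
  obtain m where l: "l = Suc m" using assms(2) by (cases l) auto
  define b where "b = (\<lambda>n. poly (\<Phi> n) 0)"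
  have beta1: "verblunsky_beta \<Phi> (int j + int l - 1) (int j - 1) = b (Suc (j + m)) * cnj (b j)" for j
    using verblunsky_beta_eq[of "Suc (j + m)" j] by (simp add: l b_def)
  have beta2: "verblunsky_beta \<Phi> (int k' + int l) (int k' + int l') =
      b (Suc (Suc k' + m)) * cnj (b (Suc (l' + k')))" for k' l'
    using verblunsky_beta_eq[of "Suc (Suc k' + m)" "Suc (l' + k')"]
    by (simp add: l b_def algebra_simps)
  have inner: "cnj (coeff (\<Phi> (m + Suc j)) m) = cnj (b (Suc j)) +
      (\<Sum>i\<in>{1..<l}. cnj (b (Suc (i + j))) * coeff (\<Phi> (j + i)) j)" for j
  proof -
    \<comment> \<open>The term at index 0 carries a leading coefficient, hence the isolated
      \<open>cnj (b (Suc j))\<close>.\<close>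
    have "{..m} = insert 0 {1..<l}" by (auto simp: l)
    then show ?thesis
      unfolding coeff_orth_poly_telescoped[OF assms(1)]
      by (simp add: coeff_orth_poly_self b_def)
  qed
  have "coeff (\<Phi> (k + l)) k =
      (\<Sum>j\<le>k. b (Suc (j + m)) * cnj (coeff (\<Phi> (m + j)) m))"
    unfolding l coeff_orth_poly_telescoped[OF assms(1)] b_def ..
  \<comment> \<open>At \<open>j = 0\<close> the coefficient is a leading one; the others have the
    form that \<open>inner\<close> expands.\<close>
  also have "\<dots> = b (Suc m) + (\<Sum>j<k. b (Suc (Suc j + m)) * cnj (coeff (\<Phi> (m + Suc j)) m))"
    by (cases k) (auto simp: sum.atMost_Suc_shift lessThan_Suc_atMost coeff_orth_poly_self
        simp del: sum.atMost_Suc)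
  also have "\<dots> = (b (Suc m) + (\<Sum>j<k. b (Suc (Suc j + m)) * cnj (b (Suc j)))) +
      (\<Sum>j<k. \<Sum>i\<in>{1..<l}. b (Suc (Suc j + m)) * cnj (b (Suc (i + j))) * coeff (\<Phi> (j + i)) j)"
    unfolding inner by (simp add: distrib_left sum.distrib sum_distrib_left mult.assoc)
  \<comment> \<open>Since \<open>b 0 = 1\<close>, the lone \<open>b (Suc m)\<close> is the missing
    term at \<open>j = 0\<close>.\<close>
  also have "b (Suc m) + (\<Sum>j<k. b (Suc (Suc j + m)) * cnj (b (Suc j))) =
      (\<Sum>j\<le>k. b (Suc (j + m)) * cnj (b j))"
    by (cases k) (auto simp: sum.atMost_Suc_shift lessThan_Suc_atMost b_def orth_poly_0
        simp del: sum.atMost_Suc)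
  finally show ?thesis
    by (simp add: beta1 beta2 atLeast0AtMost)
qed

end

end

section \<open>Iterating the recurrence\<close>

text \<open>Here \<open>p\<close> counts the remaining pairs of summations, which makes the lower
  limits independent of \<open>s\<close>, and each weight stands beside its own pair of
  sums.\<close>

fun nested_sum ::
  "(nat \<Rightarrow> nat \<Rightarrow> nat \<Rightarrow> 'a::comm_semiring_1) \<Rightarrow> (nat \<Rightarrow> nat \<Rightarrow> 'a) \<Rightarrow> nat \<Rightarrow> nat \<Rightarrow> nat \<Rightarrow> 'a"
where
  "nested_sum w c 0 k l = c k l"
| "nested_sum w c (Suc p) k l =
    (\<Sum>k'\<in>{p..<k}. \<Sum>l'\<in>{p + 1..<l}. w l k' l' * nested_sum w c p k' l')"

text \<open>Factors with index below \<open>s\<close> involve only variables already chosen, so they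
  come out of the remaining sums; storing a new pair at index \<open>s\<close> leaves them
  unchanged.\<close>

lemma iterated_sum_eq_nested_sum:
  assumes "1 \<le> s" "s \<le> Suc p"
  shows "iterated_sum p
      (\<lambda>k l. (\<Prod>i = 1..p. w (l (i - 1)) (k i) (l i)) * c (k p) (l p)) s k l =
    (\<Prod>i = 1..<s. w (l (i - 1)) (k i) (l i)) * nested_sum w c (Suc p - s) (k (s - 1)) (l (s - 1))"
  (is "iterated_sum p ?X s k l = _")
  using assms
proof (induction "Suc p - s" arbitrary: s k l)
  case 0
  then have "s = Suc p" by simp
  then show ?case
    by (subst iterated_sum.simps) (simp add: atLeastLessThanSuc_atLeastAtMost)
next
  case (Suc q)
  then have s: "s \<le> p" and q: "q = p - s" "Suc p - s = Suc (p - s)" by auto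
  have "iterated_sum p ?X (Suc s) (k(s := k')) (l(s := l')) =
      (\<Prod>i = 1..<s. w (l (i - 1)) (k i) (l i)) *
      (w (l (s - 1)) k' l' * nested_sum w c (p - s) k' l')" for k' l'
  proof -
    have "(\<Prod>i = 1..<Suc s. w ((l(s := l')) (i - 1)) ((k(s := k')) i) ((l(s := l')) i)) =
        (\<Prod>i = 1..<s. w ((l(s := l')) (i - 1)) ((k(s := k')) i) ((l(s := l')) i)) *
        w ((l(s := l')) (s - 1)) ((k(s := k')) s) ((l(s := l')) s)"
      using \<open>1 \<le> s\<close> by (rule prod.atLeastLessThan_Suc)
    also have "(\<Prod>i = 1..<s. w ((l(s := l')) (i - 1)) ((k(s := k')) i) ((l(s := l')) i)) =
        (\<Prod>i = 1..<s. w (l (i - 1)) (k i) (l i))"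
      by (intro prod.cong) auto
    also have "w ((l(s := l')) (s - 1)) ((k(s := k')) s) ((l(s := l')) s) = w (l (s - 1)) k' l'"
      using \<open>1 \<le> s\<close> by auto
    finally have split: "(\<Prod>i = 1..<Suc s. w ((l(s := l')) (i - 1)) ((k(s := k')) i) ((l(s := l')) i)) =
        (\<Prod>i = 1..<s. w (l (i - 1)) (k i) (l i)) * w (l (s - 1)) k' l'" .
    show ?thesis
      using Suc.hyps(1)[of "Suc s" "k(s := k')" "l(s := l')"] s q
      unfolding split by (simp add: mult.assoc)
  qed
  then show ?case
    using s by (subst iterated_sum.simps) (simp add: q(2) sum_distrib_left)
qed

lemma nested_sum_eq_0:
  assumes "k < p \<or> 0 < p \<and> l \<le> p"
  shows "nested_sum w c p k l = 0"
  using assms by (cases p) auto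

text \<open>The added terms have \<open>k' < p\<close> or \<open>l' \<le> p\<close>, where the inner
  nested sum has an empty range and vanishes.\<close>

lemma nested_sum_Suc_full:
  "nested_sum w c (Suc p) k l = (\<Sum>k'<k. \<Sum>l'\<in>{1..<l}. w l k' l' * nested_sum w c p k' l')"
proof -
  have "(\<Sum>l'\<in>{p + 1..<l}. w l k' l' * nested_sum w c p k' l') =
      (\<Sum>l'\<in>{1..<l}. w l k' l' * nested_sum w c p k' l')" for k'
    by (rule sum.mono_neutral_left) (auto simp: nested_sum_eq_0)
  then show ?thesis
    by (simp, intro sum.mono_neutral_left) (auto simp: nested_sum_eq_0)
qed

lemma recurrence_eq_sum_nested_sum:
  assumes rec: "\<And>k l. 1 \<le> l \<Longrightarrow> a k l = c k l + (\<Sum>k'<k. \<Sum>l'\<in>{1..<l}. w l k' l' * a k' l')"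
    and "1 \<le> l"
  shows "a k l = (\<Sum>p<l. nested_sum w c p k l)"
  using \<open>1 \<le> l\<close>
proof (induction l arbitrary: k rule: less_induct)
  case (less l)
  then obtain m where l: "l = Suc m" by (cases l) auto
  have "a k' l' = (\<Sum>p<m. nested_sum w c p k' l')" if "l' \<in> {1..<l}" for k' l'
  proof -
    have "a k' l' = (\<Sum>p<l'. nested_sum w c p k' l')"
      using that by (intro less.IH) auto
    \<comment> \<open>Terms with \<open>p \<ge> l'\<close> are zero, so all \<open>l'\<close> can
      share the bound \<open>m\<close>; the sum over \<open>p\<close> can then be moved
      outside.\<close>
    also have "\<dots> = (\<Sum>p<m. nested_sum w c p k' l')"
      using that by (intro sum.mono_neutral_left) (auto simp: l nested_sum_eq_0)
    finally show ?thesis .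
  qed
  then have "a k l = c k l + (\<Sum>k'<k. \<Sum>l'\<in>{1..<l}. \<Sum>p<m. w l k' l' * nested_sum w c p k' l')"
    using rec[OF less.prems] by (simp add: sum_distrib_left)
  also have "(\<Sum>k'<k. \<Sum>l'\<in>{1..<l}. \<Sum>p<m. w l k' l' * nested_sum w c p k' l') =
      (\<Sum>p<m. nested_sum w c (Suc p) k l)"
    unfolding nested_sum_Suc_full
    by (simp only: sum.swap[where A = "{..<m}" and B = "{..<k}"]
        sum.swap[where A = "{..<m}" and B = "{1..<l}"])
  also have "c k l + \<dots> = (\<Sum>p<l. nested_sum w c p k l)"
    by (simp add: l sum.lessThan_Suc_shift del: sum.lessThan_Suc nested_sum.simps(2))
  finally show ?case .
qed

theorem theorem2p8:
  fixes \<mu> :: "complex measure" and \<Phi> :: "nat \<Rightarrow> complex poly" and k0 l0 :: nat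
  assumes "circle_prob_measure \<mu>"
    and "infinite (measure_support \<mu>)"
    and "monic_orthogonal_polys \<mu> \<Phi>"
    and "l0 \<ge> 1"
  shows "coeff (\<Phi> (k0 + l0)) k0 =
    (\<Sum>p = 0..l0 - 1.
       iterated_sum p
         (\<lambda>k l. (\<Prod>s = 1..p. verblunsky_beta \<Phi> (int (k s) + int (l (s - 1))) (int (k s) + int (l s)))
                * (\<Sum>j = 0..k p. verblunsky_beta \<Phi> (int j + int (l p) - 1) (int j - 1)))
         1 (\<lambda>_. k0) (\<lambda>_. l0))"
proof -
  let ?w = "\<lambda>l k' l'. verblunsky_beta \<Phi> (int k' + int l) (int k' + int l')"
  let ?c = "\<lambda>k l. \<Sum>j = 0..k. verblunsky_beta \<Phi> (int j + int l - 1) (int j - 1)"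
  have "coeff (\<Phi> (k0 + l0)) k0 = (\<Sum>p<l0. nested_sum ?w ?c p k0 l0)"
    by (rule recurrence_eq_sum_nested_sum[of "\<lambda>k l. coeff (\<Phi> (k + l)) k"])
      (use assms coeff_orth_poly_recurrence in auto)
  also have "{..<l0} = {0..l0 - 1}"
    using assms(4) by auto
  finally show ?thesis
    using iterated_sum_eq_nested_sum[of 1 _ ?w ?c "\<lambda>_. k0" "\<lambda>_. l0"] by simp
qed

end
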